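(* Let $\Xi$ be a topological space and let $\Phi:\Xi\times\Xi\to\mathbb{R}$ be a continuous function such that, for all $x,y,z\in\Xi$: $\Phi(x,y)=0\Leftrightarrow x=y$; $|\Phi(x,y)|=|\Phi(y,x)|$; and $|\Phi(x,z)|\le|\Phi(x,y)|+|\Phi(y,z)|$. Assume that $\Xi$ is $\Phi$-complete. Let $A,B$ be non-empty $\Phi$-closed subsets of $\Xi$ such that $B$ is approximately $\Phi$-compact with respect to $A$. Let $\mathcal{F}:A\to B$ be a topological $p$-proximal contraction with respect to $\Phi$ such that $\mathcal{F}(A_\Phi)\subseteq B_\Phi$, and assume that $A_\Phi$ is non-empty. Then $\mathcal{F}$ has a unique best proximity point, i.e. there is exactly one $x\in A$ with $|\Phi(x,\mathcal{F}(x))|=D_\Phi(A,B)$.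
   Context: Let $\Xi$ be a topological space, $\Phi:\Xi\times\Xi\to\mathbb{R}$ continuous, and $A,B\subseteq\Xi$ non-empty. - A sequence $(\xi_n)$ in $\Xi$ is $\Phi$-convergent to $\xi\in\Xi$ if $|\Phi(\xi_n,\xi)|\to0$ as $n\to\infty$. - A sequence $(\xi_n)$ is $\Phi$-Cauchy if $|\Phi(\xi_n,\xi_{n+p})|\to0$ as $n\to\infty$, uniformly in $p=1,2,3,\dots$ (for every $\varepsilon>0$ there is $N$ with $|\Phi(\xi_n,\xi_{n+p})|<\varepsilon$ for all $n\ge N$, $p\ge1$). - $\Xi$ is $\Phi$-complete if every $\Phi$-Cauchy sequence in $\Xi$ is $\Phi$-convergent to an element of $\Xi$. - A subset $S\subseteq\Xi$ is $\Phi$-closed if whenever a sequence in $S$ is $\Phi$-convergent to $\xi\in\Xi$, then $\xi\in S$. - $D_\Phi(A,B)=\inf\{|\Phi(a,b)|:a\in A,\ b\in B\}$, and for $x\in\Xi$, $D_\Phi(x,B)=\inf\{|\Phi(x,b)|:b\in B\}$. - $A_\Phi=\{a\in A: |\Phi(a,b)|=D_\Phi(A,B)\text{ for some }b\in B\}$ and $B_\Phi=\{b\in B: |\Phi(b,a)|=D_\Phi(A,B)\text{ for some }a\in A\}$. - $B$ is approximately $\Phi$-compact with respect to $A$ if every sequence $(y_n)$ in $B$ such that $|\Phi(x,y_n)|\to D_\Phi(x,B)$ for some $x\in A$ has a subsequence that is $\Phi$-convergent to an element of $B$. - A mapping $\mathcal{F}:A\to B$ is a topological $p$-proximal contraction with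 respect to $\Phi$ if there is a real number $c\in(0,1)$ such that for all $\alpha_1,\alpha_2,\beta_1,\beta_2\in A$ with $\beta_1\ne\beta_2$: if $|\Phi(\alpha_1,\mathcal{F}(\beta_1))|=D_\Phi(A,B)$ and $|\Phi(\alpha_2,\mathcal{F}(\beta_2))|=D_\Phi(A,B)$, then $$|\Phi(\alpha_1,\alpha_2)|\le c\Big(|\Phi(\beta_1,\beta_2)|+\big||\Phi(\alpha_1,\beta_1)|-|\Phi(\alpha_2,\beta_2)|\big|\Big).$$ - A best proximity point of $\mathcal{F}:A\to B$ is a point $x\in A$ with $|\Phi(x,\mathcal{F}(x))|=D_\Phi(A,B)$. *)

theory Defs
  imports "HOL-Analysis.Analysis"
begin

definition phi_convergent :: "('a \<times> 'a \<Rightarrow> real) \<Rightarrow> (nat \<Rightarrow> 'a) \<Rightarrow> 'a \<Rightarrow> bool" where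
  "phi_convergent \<Phi> s x \<longleftrightarrow> (\<lambda>n. \<bar>\<Phi> (s n, x)\<bar>) \<longlonglongrightarrow> 0"

definition phi_Cauchy :: "('a \<times> 'a \<Rightarrow> real) \<Rightarrow> (nat \<Rightarrow> 'a) \<Rightarrow> bool" where
  "phi_Cauchy \<Phi> s \<longleftrightarrow> (\<forall>\<epsilon>>0. \<exists>N. \<forall>n\<ge>N. \<forall>p\<ge>1. \<bar>\<Phi> (s n, s (n + p))\<bar> < \<epsilon>)"

text \<open>The space is the whole type \<open>'a\<close>.\<close>

definition phi_complete :: "('a \<times> 'a \<Rightarrow> real) \<Rightarrow> bool" where
  "phi_complete \<Phi> \<longleftrightarrow> (\<forall>s. phi_Cauchy \<Phi> s \<longrightarrow> (\<exists>x. phi_convergent \<Phi> s x))"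

definition phi_closed :: "('a \<times> 'a \<Rightarrow> real) \<Rightarrow> 'a set \<Rightarrow> bool" where
  "phi_closed \<Phi> S \<longleftrightarrow> (\<forall>s x. (\<forall>n. s n \<in> S) \<and> phi_convergent \<Phi> s x \<longrightarrow> x \<in> S)"

text \<open>In the next two definitions the infimum is meaningful when the sets \<open>A\<close> and \<open>B\<close> are
  non-empty; the values are then bounded below by 0.\<close>

definition set_dist_phi :: "('a \<times> 'a \<Rightarrow> real) \<Rightarrow> 'a set \<Rightarrow> 'a set \<Rightarrow> real" where
  "set_dist_phi \<Phi> A B = Inf {\<bar>\<Phi> (a, b)\<bar> |a b. a \<in> A \<and> b \<in> B}"

definition point_dist_phi :: "('a \<times> 'a \<Rightarrow> real) \<Rightarrow> 'a \<Rightarrow> 'a set \<Rightarrow> real" where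
  "point_dist_phi \<Phi> x B = Inf {\<bar>\<Phi> (x, b)\<bar> |b. b \<in> B}"

text \<open>The sets \<open>A\<^sub>\<Phi>\<close> and \<open>B\<^sub>\<Phi>\<close>. The threshold is \<open>D\<^sub>\<Phi>(A, B)\<close> in both.\<close>

definition prox_left :: "('a \<times> 'a \<Rightarrow> real) \<Rightarrow> 'a set \<Rightarrow> 'a set \<Rightarrow> 'a set" where
  "prox_left \<Phi> A B = {a \<in> A. \<exists>b\<in>B. \<bar>\<Phi> (a, b)\<bar> = set_dist_phi \<Phi> A B}"

definition prox_right :: "('a \<times> 'a \<Rightarrow> real) \<Rightarrow> 'a set \<Rightarrow> 'a set \<Rightarrow> 'a set" where
  "prox_right \<Phi> A B = {b \<in> B. \<exists>a\<in>A. \<bar>\<Phi> (b, a)\<bar> = set_dist_phi \<Phi> A B}"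

text \<open>\<open>approx_phi_compact \<Phi> B A\<close>: the set \<open>B\<close> is approximately \<open>\<Phi>\<close>-compact with respect to \<open>A\<close>.\<close>

definition approx_phi_compact :: "('a \<times> 'a \<Rightarrow> real) \<Rightarrow> 'a set \<Rightarrow> 'a set \<Rightarrow> bool" where
  "approx_phi_compact \<Phi> B A \<longleftrightarrow>
    (\<forall>y. (\<forall>n. y n \<in> B) \<and>
         (\<exists>x\<in>A. (\<lambda>n. \<bar>\<Phi> (x, y n)\<bar>) \<longlonglongrightarrow> point_dist_phi \<Phi> x B) \<longrightarrow>
         (\<exists>r l. strict_mono r \<and> l \<in> B \<and> phi_convergent \<Phi> (y \<circ> r) l))"

text \<open>A mapping \<open>A \<rightarrow> B\<close> is a total function on \<open>'a\<close> that sends \<open>A\<close> into \<open>B\<close>; its values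
  outside \<open>A\<close> play no role.\<close>

definition top_p_proximal_contraction ::
    "('a \<times> 'a \<Rightarrow> real) \<Rightarrow> 'a set \<Rightarrow> 'a set \<Rightarrow> ('a \<Rightarrow> 'a) \<Rightarrow> bool" where
  "top_p_proximal_contraction \<Phi> A B F \<longleftrightarrow>
    F \<in> A \<rightarrow> B \<and>
    (\<exists>c. 0 < c \<and> c < 1 \<and>
      (\<forall>\<alpha>1\<in>A. \<forall>\<alpha>2\<in>A. \<forall>\<beta>1\<in>A. \<forall>\<beta>2\<in>A.
        \<beta>1 \<noteq> \<beta>2 \<and>
        \<bar>\<Phi> (\<alpha>1, F \<beta>1)\<bar> = set_dist_phi \<Phi> A B \<and>
        \<bar>\<Phi> (\<alpha>2, F \<beta>2)\<bar> = set_dist_phi \<Phi> A B \<longrightarrow>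
        \<bar>\<Phi> (\<alpha>1, \<alpha>2)\<bar> \<le> c * (\<bar>\<Phi> (\<beta>1, \<beta>2)\<bar> + \<bar>\<bar>\<Phi> (\<alpha>1, \<beta>1)\<bar> - \<bar>\<Phi> (\<alpha>2, \<beta>2)\<bar>\<bar>)))"

definition best_proximity_point ::
    "('a \<times> 'a \<Rightarrow> real) \<Rightarrow> 'a set \<Rightarrow> 'a set \<Rightarrow> ('a \<Rightarrow> 'a) \<Rightarrow> 'a \<Rightarrow> bool" where
  "best_proximity_point \<Phi> A B F x \<longleftrightarrow> x \<in> A \<and> \<bar>\<Phi> (x, F x)\<bar> = set_dist_phi \<Phi> A B"

end

theory Submission
  imports Defs
begin

text \<open>
  Write \<open>d x y = \<bar>\<Phi> (x, y)\<bar>\<close>, which is a metric. Since \<open>F\<close> maps \<open>A\<^sub>\<Phi>\<close> into \<open>B\<^sub>\<Phi>\<close>, one can iterate: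
  pick \<open>x\<^sub>n\<^sub>+\<^sub>1 \<in> A\<^sub>\<Phi>\<close> with \<open>d x\<^sub>n\<^sub>+\<^sub>1 (F x\<^sub>n) = D\<close>. If two consecutive terms agree, they are a
  best proximity point. Otherwise the contraction condition gives
  \<open>d\<^sub>n\<^sub>+\<^sub>1 \<le> c * (d\<^sub>n + \<bar>d\<^sub>n - d\<^sub>n\<^sub>+\<^sub>1\<bar>)\<close> for \<open>d\<^sub>n = d x\<^sub>n x\<^sub>n\<^sub>+\<^sub>1\<close>, which forces
  \<open>d\<^sub>n\<^sub>+\<^sub>1 \<le> 2 * c / (1 + c) * d\<^sub>n\<close>, so the sequence converges to some \<open>x \<in> A\<close>. Then
  \<open>d x (F x\<^sub>n) \<longrightarrow> D\<close>, and approximate compactness places \<open>x\<close> in \<open>A\<^sub>\<Phi>\<close>; hence \<open>d z (F x) = D\<close> for some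
  \<open>z \<in> A\<close>. Comparing \<open>z\<close> with \<open>x\<^sub>n\<^sub>+\<^sub>1\<close> by the contraction condition yields \<open>d z x \<le> c * d z x\<close> in the
  limit, i.e. \<open>z = x\<close>.
\<close>

lemma set_dist_phi_le:
  assumes "a \<in> A" "b \<in> B"
  shows "set_dist_phi \<Phi> A B \<le> \<bar>\<Phi> (a, b)\<bar>"
  unfolding set_dist_phi_def
  by (rule cInf_lower) (use assms in \<open>auto intro!: bdd_belowI[of _ 0]\<close>)

lemma set_dist_phi_le_point_dist_phi:
  assumes "a \<in> A" "B \<noteq> {}"
  shows "set_dist_phi \<Phi> A B \<le> point_dist_phi \<Phi> a B"
  unfolding point_dist_phi_def
  by (rule cInf_greatest) (use assms in \<open>auto intro: set_dist_phi_le\<close>)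

lemma point_dist_phi_le:
  assumes "b \<in> B"
  shows "point_dist_phi \<Phi> x B \<le> \<bar>\<Phi> (x, b)\<bar>"
  unfolding point_dist_phi_def
  by (rule cInf_lower) (use assms in \<open>auto intro!: bdd_belowI[of _ 0]\<close>)

text \<open>If \<open>u \<le> v\<close>, the absolute value opens as \<open>v - u\<close> and the
  terms in \<open>u\<close> are collected on the left. If \<open>u > v\<close>, the hypothesis
  collapses to \<open>u \<le> c * u\<close>, so \<open>u \<le> 0\<close>, against
  \<open>0 \<le> v\<close>. The factor is below 1 because \<open>2 * c < 1 + c\<close>.\<close>

lemma contraction_ratio:
  fixes u v c :: real
  assumes "u \<le> c * (v + \<bar>v - u\<bar>)" "0 \<le> v" "0 < c" "c < 1"
  shows "u \<le> 2 * c / (1 + c) * v"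
proof (cases "u \<le> v")
  case True
  then have "u * (1 + c) \<le> 2 * c * v"
    using assms by (simp add: algebra_simps)
  then show ?thesis
    using assms by (simp add: field_simps)
next
  case False
  then have "u \<le> c * u"
    using assms by simp
  then have "u * (1 - c) \<le> 0"
    by (simp add: algebra_simps)
  then show ?thesis
    using assms False by (simp add: mult_le_0_iff)
qed

locale phi_metric =
  fixes \<Phi> :: "'a \<times> 'a \<Rightarrow> real"
  assumes zero_iff: "\<Phi> (x, y) = 0 \<longleftrightarrow> x = y"
    and commute: "\<bar>\<Phi> (x, y)\<bar> = \<bar>\<Phi> (y, x)\<bar>"
    and triangle: "\<bar>\<Phi> (x, z)\<bar> \<le> \<bar>\<Phi> (x, y)\<bar> + \<bar>\<Phi> (y, z)\<bar>"
begin

lemma diag_zero [simp]: "\<Phi> (x, x) = 0"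
  by (simp add: zero_iff)

lemma phi_Cauchy_geometric:
  assumes step: "\<And>n. \<bar>\<Phi> (s n, s (Suc n))\<bar> \<le> C * k ^ n" and k: "0 \<le> k" "k < 1"
  shows "phi_Cauchy \<Phi> s"
  unfolding phi_Cauchy_def
proof (intro allI impI)
  fix \<epsilon> :: real assume "0 < \<epsilon>"
  have C: "0 \<le> C"
    using order_trans[OF abs_ge_zero step[of 0]] by simp
  \<comment> \<open>Finite geometric sum, multiplied through by \<open>1 - k\<close> to avoid
    division; since \<open>1 - k ^ p \<le> 1\<close>, the bound becomes uniform in
    \<open>p\<close>.\<close>
  have partial: "\<bar>\<Phi> (s n, s (n + p))\<bar> * (1 - k) \<le> C * k ^ n * (1 - k ^ p)" for n p
  proof (induction p)
    case 0
    then show ?case by simp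
  next
    case (Suc p)
    have "\<bar>\<Phi> (s n, s (n + Suc p))\<bar> * (1 - k)
        \<le> (\<bar>\<Phi> (s n, s (n + p))\<bar> + C * k ^ (n + p)) * (1 - k)"
      using triangle[of "s n" "s (n + Suc p)" "s (n + p)"] step[of "n + p"] k
      by (intro mult_right_mono) auto
    also have "\<dots> \<le> C * k ^ n * (1 - k ^ p) + C * k ^ (n + p) * (1 - k)"
      using Suc by (simp add: distrib_right)
    also have "\<dots> = C * k ^ n * (1 - k ^ Suc p)"
      by (simp add: algebra_simps power_add)
    finally show ?case .
  qed
  have "(\<lambda>n. C * k ^ n) \<longlonglongrightarrow> 0"
    using k by (intro tendsto_mult_right_zero LIMSEQ_realpow_zero) auto
  moreover have "0 < \<epsilon> * (1 - k)"
    using \<open>0 < \<epsilon>\<close> k by simp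
  ultimately have "\<forall>\<^sub>F n in sequentially. C * k ^ n < \<epsilon> * (1 - k)"
    by (rule order_tendstoD(2))
  then obtain N where N: "\<And>n. N \<le> n \<Longrightarrow> C * k ^ n < \<epsilon> * (1 - k)"
    unfolding eventually_sequentially by blast
  have "\<bar>\<Phi> (s n, s (n + p))\<bar> < \<epsilon>" if "N \<le> n" for n p
  proof -
    have "C * k ^ n * (1 - k ^ p) \<le> C * k ^ n"
      using C k by (simp add: mult_left_le)
    then have "\<bar>\<Phi> (s n, s (n + p))\<bar> * (1 - k) < \<epsilon> * (1 - k)"
      using partial[of n p] N[OF that] by linarith
    then show ?thesis
      using k by simp
  qed
  then show "\<exists>N. \<forall>n\<ge>N. \<forall>p\<ge>1. \<bar>\<Phi> (s n, s (n + p))\<bar> < \<epsilon>"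
    by blast
qed

text \<open>Taking both the \<open>\<alpha>\<close>s and the \<open>\<beta>\<close>s to be
  \<open>x\<close>, \<open>y\<close> makes the correction term vanish, leaving \<open>\<bar>\<Phi>
  (x, y)\<bar> \<le> c * \<bar>\<Phi> (x, y)\<bar>\<close> with \<open>c < 1\<close>.\<close>

lemma best_proximity_point_unique:
  assumes "top_p_proximal_contraction \<Phi> A B F"
    and x: "best_proximity_point \<Phi> A B F x" and y: "best_proximity_point \<Phi> A B F y"
  shows "x = y"
proof (rule ccontr)
  assume "x \<noteq> y"
  with assms obtain c where "c < 1" "\<bar>\<Phi> (x, y)\<bar> \<le> c * (\<bar>\<Phi> (x, y)\<bar> + \<bar>\<bar>\<Phi> (x, x)\<bar> - \<bar>\<Phi> (y, y)\<bar>\<bar>)"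
    unfolding top_p_proximal_contraction_def best_proximity_point_def by metis
  moreover have "0 < \<bar>\<Phi> (x, y)\<bar>"
    using \<open>x \<noteq> y\<close> zero_iff by simp
  ultimately show False
    by simp
qed

lemma proximal_iteration:
  assumes "F ` prox_left \<Phi> A B \<subseteq> prox_right \<Phi> A B" "prox_left \<Phi> A B \<noteq> {}" "F \<in> A \<rightarrow> B"
  obtains s where "\<And>n. s n \<in> A" "\<And>n. \<bar>\<Phi> (s (Suc n), F (s n))\<bar> = set_dist_phi \<Phi> A B"
proof -
  \<comment> \<open>The successor stays in \<open>prox_left\<close>, with \<open>F x\<close> itself
    as its partner in \<open>B\<close>, so the choice can be repeated.\<close>
  have "\<exists>y. y \<in> prox_left \<Phi> A B \<and> \<bar>\<Phi> (y, F x)\<bar> = set_dist_phi \<Phi> A B"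
    if "x \<in> prox_left \<Phi> A B" for x
  proof -
    have "F x \<in> prox_right \<Phi> A B"
      using assms(1) that by blast
    then obtain y where "y \<in> A" "\<bar>\<Phi> (F x, y)\<bar> = set_dist_phi \<Phi> A B"
      unfolding prox_right_def by blast
    moreover have "F x \<in> B"
      using assms(3) that unfolding prox_left_def by auto
    ultimately show ?thesis
      using commute[of y "F x"] unfolding prox_left_def by auto
  qed
  then have "\<exists>s. \<forall>n. s n \<in> prox_left \<Phi> A B \<and> \<bar>\<Phi> (s (Suc n), F (s n))\<bar> = set_dist_phi \<Phi> A B"
    using assms(2) by (intro dependent_nat_choice) auto
  then show thesis
    using that unfolding prox_left_def by auto
qed

lemma best_proximity_point_exists:
  assumes complete: "phi_complete \<Phi>" and "B \<noteq> {}" and closed: "phi_closed \<Phi> A"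
    and compact: "approx_phi_compact \<Phi> B A"
    and contraction: "top_p_proximal_contraction \<Phi> A B F"
    and prox: "F ` prox_left \<Phi> A B \<subseteq> prox_right \<Phi> A B" "prox_left \<Phi> A B \<noteq> {}"
  shows "\<exists>x. best_proximity_point \<Phi> A B F x"
proof -
  define D where "D = set_dist_phi \<Phi> A B"
  have F: "F \<in> A \<rightarrow> B"
    using contraction unfolding top_p_proximal_contraction_def by (rule conjunct1)
  obtain c where c: "0 < c" "c < 1"
    and contr: "\<And>a1 a2 b1 b2. \<lbrakk>a1 \<in> A; a2 \<in> A; b1 \<in> A; b2 \<in> A; b1 \<noteq> b2;
        \<bar>\<Phi> (a1, F b1)\<bar> = D; \<bar>\<Phi> (a2, F b2)\<bar> = D\<rbrakk> \<Longrightarrow>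
        \<bar>\<Phi> (a1, a2)\<bar> \<le> c * (\<bar>\<Phi> (b1, b2)\<bar> + \<bar>\<bar>\<Phi> (a1, b1)\<bar> - \<bar>\<Phi> (a2, b2)\<bar>\<bar>)"
    using contraction unfolding top_p_proximal_contraction_def D_def by metis
  obtain s where sA: "\<And>n. s n \<in> A" and sD: "\<And>n. \<bar>\<Phi> (s (Suc n), F (s n))\<bar> = D"
    using proximal_iteration[OF prox F] unfolding D_def by blast
  show ?thesis
  \<comment> \<open>The contraction condition applies only to distinct \<open>\<beta>\<close>s, so a
    repeated term is treated apart.\<close>
  proof (cases "\<exists>n. s (Suc n) = s n")
    case True
    then show ?thesis
      using sA sD unfolding best_proximity_point_def D_def by metis
  next
    case False
    then have neq: "s n \<noteq> s (Suc n)" for n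
      by metis
    define d where "d n = \<bar>\<Phi> (s n, s (Suc n))\<bar>" for n
    define k where "k = 2 * c / (1 + c)"
    have k: "0 \<le> k" "k < 1"
      using c by (auto simp: k_def)
    have d_step: "d (Suc n) \<le> k * d n" for n
      using contr[OF sA sA sA sA neq sD sD, of n] c commute[of "s (Suc n)" "s n"]
        commute[of "s (Suc (Suc n))" "s (Suc n)"]
      unfolding k_def d_def by (intro contraction_ratio) auto
    have d_le: "d n \<le> d 0 * k ^ n" for n
    proof (induction n)
      case (Suc n)
      have "d (Suc n) \<le> k * (d 0 * k ^ n)"
        using d_step[of n] mult_left_mono[OF Suc k(1)] by linarith
      then show ?case by (simp add: mult_ac)
    qed simp
    have "phi_Cauchy \<Phi> s"
      using phi_Cauchy_geometric[of s "d 0" k] d_le k unfolding d_def by blast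
    then obtain x where x: "(\<lambda>n. \<bar>\<Phi> (s n, x)\<bar>) \<longlonglongrightarrow> 0"
      using complete unfolding phi_complete_def phi_convergent_def by blast
    then have xA: "x \<in> A"
      using closed sA unfolding phi_closed_def phi_convergent_def by blast
    note x' = LIMSEQ_Suc[OF x]
    have d0: "d \<longlonglongrightarrow> 0"
    proof (rule tendsto_sandwich[OF _ _ tendsto_const])
      show "(\<lambda>n. d 0 * k ^ n) \<longlonglongrightarrow> 0"
        using k by (intro tendsto_mult_right_zero LIMSEQ_realpow_zero) auto
    qed (use d_le in \<open>auto simp: d_def\<close>)
    have FB: "F (s n) \<in> B" for n
      using F sA by blast
    have xF: "(\<lambda>n. \<bar>\<Phi> (x, F (s n))\<bar>) \<longlonglongrightarrow> D"
    proof (rule tendsto_sandwich)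
      show "\<forall>\<^sub>F n in sequentially. D \<le> \<bar>\<Phi> (x, F (s n))\<bar>"
        using set_dist_phi_le[OF xA FB] by (simp add: D_def)
      have "\<bar>\<Phi> (x, F (s n))\<bar> \<le> \<bar>\<Phi> (s (Suc n), x)\<bar> + D" for n
        using triangle[of x "F (s n)" "s (Suc n)"] sD[of n] commute[of x "s (Suc n)"] by linarith
      then show "\<forall>\<^sub>F n in sequentially. \<bar>\<Phi> (x, F (s n))\<bar> \<le> \<bar>\<Phi> (s (Suc n), x)\<bar> + D"
        by simp
      show "(\<lambda>n. \<bar>\<Phi> (s (Suc n), x)\<bar> + D) \<longlonglongrightarrow> D"
        using tendsto_add[OF x' tendsto_const[of D]] by simp
    qed auto
    \<comment> \<open>Approximate compactness refers to the distance from \<open>x\<close> to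
      \<open>B\<close>, so the limit \<open>D\<close> has to be identified with it.\<close>
    have "point_dist_phi \<Phi> x B \<le> D"
      using LIMSEQ_le_const[OF xF] point_dist_phi_le[OF FB] by blast
    then have "point_dist_phi \<Phi> x B = D"
      using set_dist_phi_le_point_dist_phi[OF xA \<open>B \<noteq> {}\<close>, of \<Phi>] by (simp add: D_def)
    then obtain r l where r: "strict_mono r" and "l \<in> B"
      and l: "(\<lambda>n. \<bar>\<Phi> (F (s (r n)), l)\<bar>) \<longlonglongrightarrow> 0"
      using compact[unfolded approx_phi_compact_def, rule_format, of "\<lambda>n. F (s n)"] FB xA xF
      unfolding phi_convergent_def by auto
    have "\<bar>\<Phi> (x, l)\<bar> \<le> D"
    proof (rule LIMSEQ_le_const)
      show "(\<lambda>n. \<bar>\<Phi> (x, F (s (r n)))\<bar> + \<bar>\<Phi> (F (s (r n)), l)\<bar>) \<longlonglongrightarrow> D"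
        using tendsto_add[OF LIMSEQ_subseq_LIMSEQ[OF xF r] l] by (simp add: o_def)
    qed (use triangle in blast)
    then have "x \<in> prox_left \<Phi> A B"
      using set_dist_phi_le[OF xA \<open>l \<in> B\<close>, of \<Phi>] xA \<open>l \<in> B\<close>
      unfolding prox_left_def D_def by fastforce
    then obtain z where zA: "z \<in> A" and "\<bar>\<Phi> (F x, z)\<bar> = D"
      using prox(1) unfolding prox_right_def D_def by blast
    then have zD: "\<bar>\<Phi> (z, F x)\<bar> = D"
      by (simp add: commute)
    have "z = x"
    proof (rule ccontr)
      assume "z \<noteq> x"
      then have pos: "0 < (1 - c) * \<bar>\<Phi> (z, x)\<bar>"
        using c zero_iff by simp
      \<comment> \<open>Gathers the vanishing terms of the estimate \<open>\<bar>\<Phi> (z, x)\<bar>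
        \<le> c * \<bar>\<Phi> (z, x)\<bar> + e n\<close> derived below.\<close>
      define e where "e n = c * (\<bar>\<Phi> (s n, x)\<bar> + d n) + \<bar>\<Phi> (s (Suc n), x)\<bar>" for n
      have "e \<longlonglongrightarrow> c * (0 + 0) + 0"
        unfolding e_def by (intro tendsto_intros x x' d0)
      then have "\<forall>\<^sub>F n in sequentially. e n < (1 - c) * \<bar>\<Phi> (z, x)\<bar>"
        using pos by (intro order_tendstoD(2)) simp_all
      then obtain N where N: "\<And>n. N \<le> n \<Longrightarrow> e n < (1 - c) * \<bar>\<Phi> (z, x)\<bar>"
        unfolding eventually_sequentially by blast
      \<comment> \<open>Consecutive terms differ, so one of \<open>s N\<close>,
        \<open>s (Suc N)\<close> is not \<open>x\<close>; the contraction condition needs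
        this.\<close>
      obtain n where n: "N \<le> n" "x \<noteq> s n"
        using neq[of N] by (metis le_Suc_eq order_refl)
      have "\<bar>\<Phi> (z, s (Suc n))\<bar> \<le> c * (\<bar>\<Phi> (x, s n)\<bar> + \<bar>\<bar>\<Phi> (z, x)\<bar> - \<bar>\<Phi> (s (Suc n), s n)\<bar>\<bar>)"
        by (rule contr[OF zA sA xA sA n(2) zD sD])
      also have "\<dots> \<le> c * (\<bar>\<Phi> (s n, x)\<bar> + (\<bar>\<Phi> (z, x)\<bar> + d n))"
        using c commute[of x "s n"] commute[of "s (Suc n)" "s n"]
        by (intro mult_left_mono) (auto simp: d_def)
      finally have "\<bar>\<Phi> (z, x)\<bar> \<le> c * \<bar>\<Phi> (z, x)\<bar> + e n"
        using triangle[of z x "s (Suc n)"] by (simp add: e_def algebra_simps)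
      then show False
        using N[OF n(1)] by (simp add: algebra_simps)
    qed
    then show ?thesis
      using zA zD unfolding best_proximity_point_def D_def by blast
  qed
qed

end

theorem theorem2p4:
  fixes \<Phi> :: "'a::topological_space \<times> 'a \<Rightarrow> real"
    and A B :: "'a set"
    and F :: "'a \<Rightarrow> 'a"
  assumes "continuous_on UNIV \<Phi>"
    and "\<And>x y. \<Phi> (x, y) = 0 \<longleftrightarrow> x = y"
    and "\<And>x y. \<bar>\<Phi> (x, y)\<bar> = \<bar>\<Phi> (y, x)\<bar>"
    and "\<And>x y z. \<bar>\<Phi> (x, z)\<bar> \<le> \<bar>\<Phi> (x, y)\<bar> + \<bar>\<Phi> (y, z)\<bar>"
    and "phi_complete \<Phi>"
    and "A \<noteq> {}" and "B \<noteq> {}"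
    and "phi_closed \<Phi> A" and "phi_closed \<Phi> B"
    and "approx_phi_compact \<Phi> B A"
    and "top_p_proximal_contraction \<Phi> A B F"
    and "F ` prox_left \<Phi> A B \<subseteq> prox_right \<Phi> A B"
    and "prox_left \<Phi> A B \<noteq> {}"
  shows "\<exists>!x. best_proximity_point \<Phi> A B F x"
proof -
  interpret phi_metric \<Phi>
    by unfold_locales (use assms(2-4) in auto)
  show ?thesis
    using best_proximity_point_exists[OF assms(5,7,8,10-13)]
      best_proximity_point_unique[OF assms(11)] by blast
qed

end
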